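(* Let $n\geq 4$ be composite, let $G_n=\mathbb{Z}_n\times\mathbb{Z}_n$, let $S=\{(i,0),(0,i),(i,i): 1\leq i\leq n-1\}\subset G_n$, and let $\Gamma(n)=\mathrm{Cay}(G_n;S)$ (vertices $G_n$, $g\sim h$ iff $h-g\in S$). Then $\Gamma(n)$ is not edge-transitive.
   Context: A graph is edge-transitive if its automorphism group acts transitively on its set of (undirected) edges. *)

theory Defs
  imports
    "HOL-Algebra.Elementary_Groups"
    "HOL-Algebra.Bij"
    "HOL-Computational_Algebra.Primes"
    "Graph_Theory.Pair_Digraph"
begin

(* An undirected graph is a symmetric pair digraph: each edge {u, v} is stored as the
   two arcs (u, v) and (v, u). *)

definition undirected_edges :: "'a pair_pre_digraph \<Rightarrow> 'a set set" where
  "undirected_edges \<Gamma> = {{u, v} | u v. (u, v) \<in> parcs \<Gamma>}"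

(* Elements of Bij are extensional, so these functions form a subgroup of BijGroup. *)

definition graph_automorphisms :: "'a pair_pre_digraph \<Rightarrow> ('a \<Rightarrow> 'a) set" where
  "graph_automorphisms \<Gamma> =
     {f \<in> Bij (pverts \<Gamma>).
        \<forall>u \<in> pverts \<Gamma>. \<forall>v \<in> pverts \<Gamma>. (f u, f v) \<in> parcs \<Gamma> \<longleftrightarrow> (u, v) \<in> parcs \<Gamma>}"

definition edge_transitive :: "'a pair_pre_digraph \<Rightarrow> bool" where
  "edge_transitive \<Gamma> \<longleftrightarrow>
     (\<forall>e \<in> undirected_edges \<Gamma>. \<forall>e' \<in> undirected_edges \<Gamma>.
        \<exists>f \<in> graph_automorphisms \<Gamma>. f ` e = e')"

definition cayley_graph :: "('a, 'b) monoid_scheme \<Rightarrow> 'a set \<Rightarrow> 'a pair_pre_digraph" where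
  "cayley_graph G S =
     \<lparr>pverts = carrier G,
      parcs = {(g, h). g \<in> carrier G \<and> h \<in> carrier G \<and> h \<otimes>\<^bsub>G\<^esub> inv\<^bsub>G\<^esub> g \<in> S}\<rparr>"

definition Zn_square :: "nat \<Rightarrow> (int \<times> int) monoid" where
  "Zn_square n = integer_mod_group n \<times>\<times> integer_mod_group n"

definition connection_set :: "nat \<Rightarrow> (int \<times> int) set" where
  "connection_set n = (\<Union>i \<in> {1..int n - 1}. {(i, 0), (0, i), (i, i)})"

definition \<Gamma> :: "nat \<Rightarrow> (int \<times> int) pair_pre_digraph" where
  "\<Gamma> n = cayley_graph (Zn_square n) (connection_set n)"

lemma (in group) pair_graph_cayley_graph:
  assumes "finite (carrier G)" and "\<one> \<notin> S" and "\<And>s. s \<in> S \<Longrightarrow> inv s \<in> S"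
  shows "pair_graph (cayley_graph G S)"
proof -
  have "finite {(g, h). g \<in> carrier G \<and> h \<in> carrier G \<and> h \<otimes> inv g \<in> S}"
    by (rule finite_subset[OF _ finite_cartesian_product[OF assms(1) assms(1)]]) auto
  moreover have "g \<otimes> inv h \<in> S" if "g \<in> carrier G" "h \<in> carrier G" "h \<otimes> inv g \<in> S" for g h
    using assms(3)[OF that(3)] that by (simp add: inv_mult_group)
  ultimately show ?thesis
    using assms(1,2)
    by unfold_locales
      (auto simp: cayley_graph_def symmetric_def sym_def arcs_ends_def arc_to_ends_def image_iff r_inv)
qed

lemma pair_graph_\<Gamma>:
  assumes "n > 0"
  shows "pair_graph (\<Gamma> n)"
proof -
  have car: "carrier (Zn_square n) = {0..<int n} \<times> {0..<int n}"
    using assms by (simp add: Zn_square_def carrier_integer_mod_group)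
  interpret Z: group "integer_mod_group n" by simp
  interpret G: group "Zn_square n"
    unfolding Zn_square_def by (intro DirProd_group) simp_all
  have inv: "inv\<^bsub>Zn_square n\<^esub> (a, b) = ((- a) mod int n, (- b) mod int n)"
    if "a \<in> {0..<int n}" "b \<in> {0..<int n}" for a b
    using that assms unfolding Zn_square_def
    by (subst inv_DirProd) (auto simp: carrier_integer_mod_group inv_integer_mod_group)
  have m: "(- i) mod int n = int n - i" if "1 \<le> i" "i \<le> int n - 1" for i
    using that by (simp add: zmod_zminus1_eq_if)
  show ?thesis
    unfolding \<Gamma>_def
  proof (rule G.pair_graph_cayley_graph)
    show "finite (carrier (Zn_square n))" by (simp add: car)
    show "\<one>\<^bsub>Zn_square n\<^esub> \<notin> connection_set n"
      by (auto simp: Zn_square_def connection_set_def)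
    show "inv\<^bsub>Zn_square n\<^esub> s \<in> connection_set n" if s: "s \<in> connection_set n" for s
    proof -
      obtain i where i: "1 \<le> i" "i \<le> int n - 1" "s \<in> {(i, 0), (0, i), (i, i)}"
        using s unfolding connection_set_def by auto
      then have "inv\<^bsub>Zn_square n\<^esub> s \<in> {(int n - i, 0), (0, int n - i), (int n - i, int n - i)}"
        by (auto simp: inv m)
      moreover have "int n - i \<in> {1..int n - 1}" using i by simp
      ultimately show ?thesis unfolding connection_set_def by blast
    qed
  qed
qed

end

theory Submission
  imports Defs "HOL-Library.Product_Plus"
begin

text \<open>
  A triangle contained in a line (a coset of one of the three cyclic subgroups making up the
  connection set) lies in a 4-clique, as lines have \<open>n \<ge> 4\<close> points. Hence a triangle
  \<open>u, v, w\<close> that is a maximal clique has its edges in three different directions, and this forces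
  \<open>w - u = \<rho> (v - u)\<close> or \<open>w - u = \<rho>\<^sup>-\<^sup>1 (v - u)\<close> with
  \<open>\<rho> (x, y) = (x - y, x)\<close>. As \<open>\<rho>\<^sup>3 = -1\<close>, three successive maximal triangles
  around \<open>v\<close>, the first of which contains \<open>u\<close>, lead from \<open>u\<close> to \<open>2v - u\<close>. For edges in
  direction \<open>(1, 0)\<close> such triangles exist, so automorphisms map \<open>(0, 0), (1, 0), (2, 0), ...\<close>
  to arithmetic progressions. If \<open>n = pq\<close> and the edge from \<open>(0, 0)\<close> to \<open>(1, 0)\<close> is
  mapped to the one from \<open>(0, 0)\<close> to \<open>(p, 0)\<close>, the progression closes up after
  \<open>q < n\<close> steps, contradicting injectivity.
\<close>

section \<open>Adjacency on integer pairs modulo \<open>m\<close>\<close>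

definition null_mod :: "int \<Rightarrow> int \<times> int \<Rightarrow> bool" where
  "null_mod m d \<longleftrightarrow> m dvd fst d \<and> m dvd snd d"

text \<open>The connection set read on integer representatives: the three divisibilities cut out the
  subgroups generated by \<open>(0, 1)\<close>, \<open>(1, 0)\<close> and \<open>(1, 1)\<close>
  modulo \<open>m\<close>. Allowing all integer pairs avoids reducing sums and differences.\<close>

definition connector :: "int \<Rightarrow> int \<times> int \<Rightarrow> bool" where
  "connector m d \<longleftrightarrow>
     (m dvd fst d \<or> m dvd snd d \<or> m dvd fst d - snd d) \<and> \<not> null_mod m d"

definition adj :: "int \<Rightarrow> int \<times> int \<Rightarrow> int \<times> int \<Rightarrow> bool" where
  "adj m u v \<longleftrightarrow> connector m (v - u)"

definition maximal_triangle :: "int \<Rightarrow> int \<times> int \<Rightarrow> int \<times> int \<Rightarrow> int \<times> int \<Rightarrow> bool" where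
  "maximal_triangle m u v w \<longleftrightarrow> adj m u v \<and> adj m u w \<and> adj m v w \<and>
     (\<nexists>x. adj m u x \<and> adj m v x \<and> adj m w x)"

text \<open>Multiplication by a primitive sixth root of unity: the characteristic polynomial is
  \<open>t^2 - t + 1\<close>. The directions are permuted cyclically up to sign,
  \<open>(1, 0)\<close> to \<open>(1, 1)\<close> to \<open>(0, 1)\<close> to
  \<open>(-1, 0)\<close>.\<close>

definition rot :: "int \<times> int \<Rightarrow> int \<times> int" where
  "rot d = (fst d - snd d, fst d)"

definition rot_inv :: "int \<times> int \<Rightarrow> int \<times> int" where
  "rot_inv d = (snd d, snd d - fst d)"

lemma connector_cong:
  assumes "null_mod m (d - e)"
  shows "connector m d \<longleftrightarrow> connector m e"
proof -
  obtain k l where "fst d = fst e + m * k" "snd d = snd e + m * l"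
    using assms by (auto simp: null_mod_def elim!: dvdE) (metis add.commute diff_add_cancel)
  moreover have "m dvd fst e + m * k - (snd e + m * l) \<longleftrightarrow> m dvd fst e - snd e"
  proof -
    have "fst e + m * k - (snd e + m * l) = (fst e - snd e) + m * (k - l)"
      by (simp add: algebra_simps)
    then show ?thesis by (simp only: dvd_add_times_triv_right_iff)
        (simp add: dvd_add_left_iff)
  qed
  ultimately show ?thesis
    by (simp add: connector_def null_mod_def dvd_add_left_iff)
qed

lemma connector_minus: "connector m (u - v) \<longleftrightarrow> connector m (v - u)"
proof -
  have "m dvd fst u - fst v - (snd u - snd v) \<longleftrightarrow> m dvd fst v - fst u - (snd v - snd u)"
    by (subst dvd_diff_commute) (simp add: algebra_simps)
  then show ?thesis
    by (simp add: connector_def null_mod_def dvd_diff_commute[of m "fst u"] dvd_diff_commute[of m "snd u"])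
qed

section \<open>Maximal triangles as rotations\<close>

lemma maximal_triangle_swap: "maximal_triangle m u v w \<Longrightarrow> maximal_triangle m v u w"
  unfolding maximal_triangle_def adj_def using connector_minus by blast

text \<open>The residues 1, 2, 3 are distinct and nonzero for \<open>m \<ge> 4\<close>, and two
  forbidden residues cannot exhaust them. This supplies a fourth point on a line through three given
  ones.\<close>

lemma ex_avoiding_residues:
  fixes m i j :: int
  assumes "m \<ge> 4"
  shows "\<exists>k. \<not> m dvd k \<and> \<not> m dvd k - i \<and> \<not> m dvd k - j"
proof -
  have "\<exists>k \<in> {1, 2, 3}. k \<noteq> i mod m \<and> k \<noteq> j mod m" by simp arith
  then obtain k where k: "k \<in> {1, 2, 3}" "k \<noteq> i mod m" "k \<noteq> j mod m" by blast
  moreover from k(1) assms have "k mod m = k" by auto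
  moreover from k(1) assms have "\<not> m dvd k" using zdvd_not_zless[of k m] by auto
  ultimately show ?thesis by (metis mod_eq_dvd_iff)
qed

lemma maximal_triangle_rot:
  assumes "m \<ge> 4" and T: "maximal_triangle m u v w"
  shows "null_mod m (w - u - rot (v - u)) \<or> null_mod m (w - u - rot_inv (v - u))"
proof -
  obtain d1 d2 e1 e2 where d: "v - u = (d1, d2)" and e: "w - u = (e1, e2)"
    by (metis surj_pair)
  have c: "connector m (d1, d2)" "connector m (e1, e2)" "connector m (e1 - d1, e2 - d2)"
  proof -
    have "w - v = (w - u) - (v - u)" by simp
    then show "connector m (e1 - d1, e2 - d2)"
      using T d e unfolding maximal_triangle_def adj_def by simp
  qed (use T d e in \<open>simp_all add: maximal_triangle_def adj_def\<close>)
  have no: "\<not> (connector m (x1, x2) \<and> connector m (x1 - d1, x2 - d2) \<and> connector m (x1 - e1, x2 - e2))"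
    for x1 x2
  proof -
    have "(u + (x1, x2)) - v = (x1, x2) - (v - u)" "(u + (x1, x2)) - w = (x1, x2) - (w - u)"
      "(u + (x1, x2)) - u = (x1, x2)" by simp_all
    then show ?thesis
      using T unfolding maximal_triangle_def adj_def d e by (metis diff_Pair)
  qed
  \<comment> \<open>If the triangle lay on one line through \<open>u\<close>, a fourth point of that
    line would be adjacent to all three vertices. Relative to \<open>u\<close> this point is
    \<open>(k, 0)\<close> here, \<open>(0, k)\<close> for \<open>l2\<close> and
    \<open>(k, k)\<close> for \<open>l3\<close>.\<close>
  have l1: "\<not> (m dvd d2 \<and> m dvd e2)"
    using ex_avoiding_residues[OF assms(1), of d1 e1] no[of _ 0]
    by (auto simp: connector_def null_mod_def)
  have l2: "\<not> (m dvd d1 \<and> m dvd e1)"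
    using ex_avoiding_residues[OF assms(1), of d2 e2] no[of 0]
    by (auto simp: connector_def null_mod_def)
  have l3: "\<not> (m dvd d1 - d2 \<and> m dvd e1 - e2)"
  proof
    assume *: "m dvd d1 - d2 \<and> m dvd e1 - e2"
    obtain k where k: "\<not> m dvd k" "\<not> m dvd k - d1" "\<not> m dvd k - e1"
      using ex_avoiding_residues[OF assms(1)] by blast
    have "m dvd (k - d1) - (k - d2)" "m dvd (k - e1) - (k - e2)"
      using * by (simp_all add: dvd_diff_commute)
    with k no[of k k] show False by (simp add: connector_def null_mod_def)
  qed
  have *: "(m dvd e1 - (d1 - d2) \<and> m dvd e2 - d1) \<or> (m dvd e1 - d2 \<and> m dvd e2 - (d2 - d1))"
  proof -
    have "m dvd d1 \<or> m dvd d2 \<or> m dvd d1 - d2" "m dvd e1 \<or> m dvd e2 \<or> m dvd e1 - e2"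
      "m dvd e1 - d1 \<or> m dvd e2 - d2 \<or> m dvd (e1 - d1) - (e2 - d2)"
      "\<not> (m dvd d1 \<and> m dvd d2)" "\<not> (m dvd e1 \<and> m dvd e2)"
      using c by (auto simp: connector_def null_mod_def)
    \<comment> \<open>If two of the differences \<open>d\<close>, \<open>e\<close>,
      \<open>e - d\<close> share a direction, the third has it too, against \<open>l1\<close>,
      \<open>l2\<close> or \<open>l3\<close>. Each of the six assignments of distinct directions
      determines \<open>e\<close> from \<open>d\<close>: three give \<open>rot\<close>, three give
      \<open>rot_inv\<close>. The linear consequences listed make this case split purely
      propositional.\<close>
    moreover have "m dvd d1 \<Longrightarrow> m dvd e1 - d1 \<Longrightarrow> m dvd e1"
      "m dvd e1 - e2 \<Longrightarrow> m dvd e1 \<Longrightarrow> m dvd e2"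
      "m dvd e2 \<Longrightarrow> m dvd e2 - d2 \<Longrightarrow> m dvd d2"
      "m dvd d1 \<Longrightarrow> m dvd (e1 - d1) - (e2 - d2) \<Longrightarrow> m dvd e1 - (e2 - d2)"
      "m dvd e2 \<Longrightarrow> m dvd e1 - (e2 - d2) \<Longrightarrow> m dvd e1 + d2"
      "m dvd d1 \<Longrightarrow> m dvd e1 + d2 \<Longrightarrow> m dvd e1 - (d1 - d2)"
      "m dvd d1 \<Longrightarrow> m dvd e2 \<Longrightarrow> m dvd e2 - d1"
      "m dvd e1 - e2 \<Longrightarrow> m dvd e2 - d2 \<Longrightarrow> m dvd e1 - d2"
      "m dvd e2 - d2 \<Longrightarrow> m dvd d1 \<Longrightarrow> m dvd e2 - (d2 - d1)"
      "m dvd e1 - e2 \<Longrightarrow> m dvd e1 - (e2 - d2) \<Longrightarrow> m dvd d2"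
      "m dvd e1 \<Longrightarrow> m dvd e1 - d1 \<Longrightarrow> m dvd d1"
      "m dvd d2 \<Longrightarrow> m dvd e2 - d2 \<Longrightarrow> m dvd e2"
      "m dvd e1 \<Longrightarrow> m dvd d2 \<Longrightarrow> m dvd e1 - d2"
      "m dvd e1 \<Longrightarrow> m dvd (e1 - d1) - (e2 - d2) \<Longrightarrow> m dvd e2 - (d2 - d1)"
      "m dvd e1 - d1 \<Longrightarrow> m dvd d2 \<Longrightarrow> m dvd e1 - (d1 - d2)"
      "m dvd e1 - d1 \<Longrightarrow> m dvd e1 - e2 \<Longrightarrow> m dvd e2 - d1"
      "m dvd e1 - e2 \<Longrightarrow> m dvd e2 \<Longrightarrow> m dvd e1"
      "m dvd e1 - e2 \<Longrightarrow> m dvd (e1 - d1) - (e2 - d2) \<Longrightarrow> m dvd d1 - d2"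
      "m dvd d1 - d2 \<Longrightarrow> m dvd d1 \<Longrightarrow> m dvd d2"
      "m dvd d1 - d2 \<Longrightarrow> m dvd e1 \<Longrightarrow> m dvd e1 - (d1 - d2)"
      "m dvd d1 - d2 \<Longrightarrow> m dvd e2 - d2 \<Longrightarrow> m dvd e2 - d1"
      "m dvd d1 - d2 \<Longrightarrow> m dvd (e1 - d1) - (e2 - d2) \<Longrightarrow> m dvd e1 - e2"
      "m dvd d1 - d2 \<Longrightarrow> m dvd e1 - d1 \<Longrightarrow> m dvd e1 - d2"
      "m dvd d1 - d2 \<Longrightarrow> m dvd e2 \<Longrightarrow> m dvd e2 - (d2 - d1)"
      "m dvd d1 - d2 \<Longrightarrow> m dvd d2 \<Longrightarrow> m dvd d1"
      by (smt (verit) dvd_add dvd_diff)+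
    ultimately show ?thesis using l1 l2 l3 by argo
  qed
  then show ?thesis by (simp add: d e null_mod_def rot_def rot_inv_def)
qed

section \<open>Composing rotations up to congruence\<close>

lemma rot_rot_inv_null:
  assumes "null_mod m (q - rot p)" and "null_mod m (r - rot_inv q)"
  shows "null_mod m (r - p)"
proof -
  \<comment> \<open>Each coordinate is written as a combination of the errors in the assumed
    congruences, all of which are divisible by \<open>m\<close>. The next three lemmas follow the
    same pattern.\<close>
  have "fst r - fst p = (fst r - snd q) + (snd q - fst p)"
    "snd r - snd p = (snd r - (snd q - fst q)) + (snd q - fst p) - (fst q - (fst p - snd p))"
    by simp_all
  then show ?thesis
    using assms unfolding null_mod_def rot_def rot_inv_def
    by (simp only: fst_diff snd_diff fst_conv snd_conv dvd_add dvd_diff simp_thms)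
qed

lemma rot_inv_rot_null:
  assumes "null_mod m (q - rot_inv p)" and "null_mod m (r - rot q)"
  shows "null_mod m (r - p)"
proof -
  have "fst r - fst p = (fst r - (fst q - snd q)) + (fst q - snd p) - (snd q - (snd p - fst p))"
    "snd r - snd p = (snd r - fst q) + (fst q - snd p)"
    by simp_all
  then show ?thesis
    using assms unfolding null_mod_def rot_def rot_inv_def
    by (simp only: fst_diff snd_diff fst_conv snd_conv dvd_add dvd_diff simp_thms)
qed

lemma rot_thrice_null:
  assumes "null_mod m (q - rot p)" and "null_mod m (r - rot q)" and "null_mod m (s - rot r)"
  shows "null_mod m (s + p)"
proof -
  have "fst s + fst p = (fst s - (fst r - snd r)) + (fst r - (fst q - snd q)) - (snd r - fst q) - (snd q - fst p)"
    "snd s + snd p = (snd s - fst r) + (fst r - (fst q - snd q)) + (fst q - (fst p - snd p)) - (snd q - fst p)"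
    by simp_all
  then show ?thesis
    using assms unfolding null_mod_def rot_def
    by (simp only: fst_diff snd_diff fst_add snd_add fst_conv snd_conv dvd_add dvd_diff simp_thms)
qed

lemma rot_inv_thrice_null:
  assumes "null_mod m (q - rot_inv p)" and "null_mod m (r - rot_inv q)" and "null_mod m (s - rot_inv r)"
  shows "null_mod m (s + p)"
proof -
  have "fst s + fst p = (fst s - snd r) + (snd r - (snd q - fst q)) - (fst q - snd p) + (snd q - (snd p - fst p))"
    "snd s + snd p = (snd s - (snd r - fst r)) + (snd r - (snd q - fst q)) - (fst r - snd q) - (fst q - snd p)"
    by simp_all
  then show ?thesis
    using assms unfolding null_mod_def rot_inv_def
    by (simp only: fst_diff snd_diff fst_add snd_add fst_conv snd_conv dvd_add dvd_diff simp_thms)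
qed

text \<open>Seen from \<open>v\<close>, each of the steps from \<open>u\<close> to \<open>w\<close>
  to \<open>x\<close> to \<open>y\<close> is a rotation by \<open>rot\<close> or
  \<open>rot_inv\<close>. Two consecutive steps of opposite sense would lead back to the point
  before, which the two incongruences exclude. So all three turn the same way and compose to
  -1.\<close>

lemma reflected_point:
  assumes "m \<ge> 4" and "maximal_triangle m u v w" and "maximal_triangle m v w x"
    and "\<not> null_mod m (x - u)" and "maximal_triangle m v x y" and "\<not> null_mod m (y - w)"
  shows "null_mod m (y - v - (v - u))"
proof -
  note T = maximal_triangle_rot[OF assms(1)]
  note 1 = T[OF maximal_triangle_swap[OF assms(2)]] and 2 = T[OF assms(3)] and 3 = T[OF assms(5)]
  have "\<not> null_mod m ((x - v) - (u - v))" "\<not> null_mod m ((y - v) - (w - v))"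
    using assms(4,6) by simp_all
  then have "null_mod m ((y - v) + (u - v))"
    using 1 2 3
      rot_rot_inv_null[of m "w - v" "u - v" "x - v"] rot_rot_inv_null[of m "x - v" "w - v" "y - v"]
      rot_inv_rot_null[of m "w - v" "u - v" "x - v"] rot_inv_rot_null[of m "x - v" "w - v" "y - v"]
      rot_thrice_null[of m "w - v" "u - v" "x - v" "y - v"]
      rot_inv_thrice_null[of m "w - v" "u - v" "x - v" "y - v"]
    by argo
  then show ?thesis by (simp add: algebra_simps)
qed

section \<open>Maximal triangles under automorphisms and along a row\<close>

lemma maximal_triangle_map:
  assumes "\<And>u v. adj m (g u) (g v) \<longleftrightarrow> adj m u v" and "\<And>y. \<exists>x. null_mod m (g x - y)"
    and "maximal_triangle m u v w"
  shows "maximal_triangle m (g u) (g v) (g w)"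
proof -
  \<comment> \<open>A common neighbour \<open>y\<close> of the image triangle need not be a value of
    \<open>g\<close>, but it is congruent to some \<open>g x\<close>. Then \<open>x\<close> is a
    common neighbour of the original triangle.\<close>
  have "\<exists>x. \<forall>v. adj m (g v) y \<longleftrightarrow> adj m v x" for y
  proof -
    obtain x where "null_mod m (g x - y)" using assms(2) by blast
    then have "null_mod m ((g x - g v) - (y - g v))" for v by simp
    then show ?thesis using assms(1) connector_cong unfolding adj_def by blast
  qed
  then show ?thesis using assms(1,3) unfolding maximal_triangle_def by metis
qed

text \<open>Take the first triangle with \<open>(a, b)\<close> at the origin. Comparing the possible
  directions from a common neighbour to the vertices leaves, apart from the vertices themselves and
  cases forcing \<open>m dvd 1\<close>, only the point \<open>(0, -1)\<close>. It is adjacent to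
  \<open>(1, 1)\<close> only if \<open>m dvd 2\<close>, which \<open>m \<ge> 3\<close> rules
  out.\<close>

lemma maximal_triangles_around:
  assumes "m \<ge> 3"
  shows "maximal_triangle m (a, b) (a + 1, b) (a + 1, b + 1)"
    and "maximal_triangle m (a, b) (a, b + 1) (a + 1, b + 1)"
    and "maximal_triangle m (a, b) (a + 1, b + 1) (a + 1, b)"
proof -
  have m: "\<not> m dvd 1" "\<not> m dvd 2" using assms zdvd_not_zless[of 1 m] zdvd_not_zless[of 2 m] by linarith+
  have no_apex: False if "connector m (x, y)" "connector m (x - 1, y)" "connector m (x - 1, y - 1)" for x y
  proof -
    have "m dvd x \<or> m dvd y \<or> m dvd x - y" "m dvd x - 1 \<or> m dvd y \<or> m dvd x - 1 - y"
      "m dvd x - 1 \<or> m dvd y - 1 \<or> m dvd x - y" "\<not> (m dvd x \<and> m dvd y)"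
      "\<not> (m dvd x - 1 \<and> m dvd y)" "\<not> (m dvd x - 1 \<and> m dvd y - 1)"
      using that by (simp_all add: connector_def null_mod_def)
    moreover have "m dvd x \<Longrightarrow> m dvd x - 1 \<Longrightarrow> m dvd 1"
      "m dvd x \<Longrightarrow> m dvd x - 1 - y \<Longrightarrow> m dvd y + 1"
      "m dvd y - 1 \<Longrightarrow> m dvd y + 1 \<Longrightarrow> m dvd 2"
      "m dvd x \<Longrightarrow> m dvd x - y \<Longrightarrow> m dvd y"
      "m dvd y \<Longrightarrow> m dvd y - 1 \<Longrightarrow> m dvd 1"
      "m dvd y \<Longrightarrow> m dvd x - y \<Longrightarrow> m dvd x"
      "m dvd y \<Longrightarrow> m dvd x - 1 - y \<Longrightarrow> m dvd x - 1"
      "m dvd x - y \<Longrightarrow> m dvd x - 1 \<Longrightarrow> m dvd y - 1"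
      "m dvd x - y \<Longrightarrow> m dvd x - 1 - y \<Longrightarrow> m dvd 1"
      by (smt (verit) dvd_add dvd_diff)+
    ultimately show False using m by argo
  qed
  \<comment> \<open>Exchanging the coordinates preserves adjacency and carries the second triangle
    to the first.\<close>
  have no_apex_swap: False if "connector m (x, y)" "connector m (x, y - 1)" "connector m (x - 1, y - 1)" for x y
  proof (rule no_apex)
    show "connector m (y, x)" "connector m (y - 1, x)" "connector m (y - 1, x - 1)"
      using that dvd_diff_commute[of m x y] dvd_diff_commute[of m x "y - 1"]
        dvd_diff_commute[of m "x - 1" "y - 1"]
      by (auto simp: connector_def null_mod_def)
  qed
  show 1: "maximal_triangle m (a, b) (a + 1, b) (a + 1, b + 1)"
    unfolding maximal_triangle_def adj_def
  proof (intro conjI notI)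
    assume "\<exists>x. connector m (x - (a, b)) \<and> connector m (x - (a + 1, b)) \<and> connector m (x - (a + 1, b + 1))"
    then obtain x y where "connector m (x - a, y - b)" "connector m (x - (a + 1), y - b)"
      "connector m (x - (a + 1), y - (b + 1))" by auto
    then show False using no_apex[of "x - a" "y - b"] by (simp add: algebra_simps)
  qed (use m in \<open>simp_all add: connector_def null_mod_def\<close>)
  show "maximal_triangle m (a, b) (a, b + 1) (a + 1, b + 1)"
    unfolding maximal_triangle_def adj_def
  proof (intro conjI notI)
    assume "\<exists>x. connector m (x - (a, b)) \<and> connector m (x - (a, b + 1)) \<and> connector m (x - (a + 1, b + 1))"
    then obtain x y where "connector m (x - a, y - b)" "connector m (x - a, y - (b + 1))"
      "connector m (x - (a + 1), y - (b + 1))" by auto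
    then show False using no_apex_swap[of "x - a" "y - b"] by (simp add: algebra_simps)
  qed (use m in \<open>simp_all add: connector_def null_mod_def\<close>)
  show "maximal_triangle m (a, b) (a + 1, b + 1) (a + 1, b)"
    using 1 connector_minus unfolding maximal_triangle_def adj_def by blast
qed

text \<open>Three maximal triangles fill the half hexagon above \<open>(a, 0)\<close>, from
  \<open>(a - 1, 0)\<close> to \<open>(a + 1, 0)\<close>. Their images are again maximal, so
  \<open>g (a + 1, 0)\<close> is the reflection of \<open>g (a - 1, 0)\<close> in
  \<open>g (a, 0)\<close> up to congruence. Consecutive differences thus stay congruent to the first
  one, and they add up.\<close>

lemma image_of_row:
  fixes g :: "int \<times> int \<Rightarrow> int \<times> int"
  assumes "m \<ge> 4"
    and adj: "\<And>u v. adj m (g u) (g v) \<longleftrightarrow> adj m u v"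
    and null: "\<And>u v. null_mod m (g u - g v) \<longleftrightarrow> null_mod m (u - v)"
    and surj: "\<And>y. \<exists>x. null_mod m (g x - y)"
    and D: "g (1, 0) - g (0, 0) = (D1, D2)"
  shows "null_mod m (g (int k, 0) - g (0, 0) - (int k * D1, int k * D2))"
proof -
  have [simp]: "\<bar>m\<bar> \<noteq> 1" using assms(1) by linarith
  note T = maximal_triangle_map[of m g, OF adj surj]
  have step: "null_mod m (g (a + 1, 0) - g (a, 0) - (g (a, 0) - g (a - 1, 0)))" for a
  proof (rule reflected_point[OF assms(1)])
    show "maximal_triangle m (g (a - 1, 0)) (g (a, 0)) (g (a, 1))"
      using maximal_triangles_around(1)[of m "a - 1" 0] assms(1) by (intro T) simp
    show "maximal_triangle m (g (a, 0)) (g (a, 1)) (g (a + 1, 1))"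
      using maximal_triangles_around(2)[of m a 0] assms(1) by (intro T) simp
    show "maximal_triangle m (g (a, 0)) (g (a + 1, 1)) (g (a + 1, 0))"
      using maximal_triangles_around(3)[of m a 0] assms(1) by (intro T) simp
  \<comment> \<open>The remaining incongruences concern \<open>(2, 1)\<close> and
    \<open>(1, -1)\<close>, both with a coordinate that is a unit in the integers.\<close>
  qed (simp_all add: null, simp_all add: null_mod_def)
  have diff: "null_mod m (g (int k + 1, 0) - g (int k, 0) - (D1, D2))" for k
  proof (induction k)
    case 0
    then show ?case by (simp add: D null_mod_def)
  next
    case (Suc k)
    have "g (int (Suc k) + 1, 0) - g (int (Suc k), 0) - (D1, D2)
       = (g (int k + 1 + 1, 0) - g (int k + 1, 0) - (g (int k + 1, 0) - g (int k, 0)))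
         + (g (int k + 1, 0) - g (int k, 0) - (D1, D2))"
      by (simp add: algebra_simps)
    with Suc step[of "int k + 1"] show ?case
      by (simp only: null_mod_def fst_add snd_add dvd_add simp_thms add_diff_cancel_right')
  qed
  show ?thesis
  proof (induction k)
    case 0
    then show ?case by (simp add: null_mod_def)
  next
    case (Suc k)
    have "g (int (Suc k), 0) - g (0, 0) - (int (Suc k) * D1, int (Suc k) * D2)
       = (g (int k + 1, 0) - g (int k, 0) - (D1, D2)) + (g (int k, 0) - g (0, 0) - (int k * D1, int k * D2))"
      by (simp add: algebra_simps prod_eq_iff)
    with Suc diff[of k] show ?case by (simp only: null_mod_def fst_add snd_add dvd_add simp_thms)
  qed
qed

section \<open>The Cayley graph in terms of integer pairs\<close>

lemma pverts_\<Gamma>: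
  assumes "n > 0"
  shows "pverts (\<Gamma> n) = {0..<int n} \<times> {0..<int n}"
  using assms by (simp add: \<Gamma>_def cayley_graph_def Zn_square_def carrier_integer_mod_group)

lemma mem_connection_set_iff:
  assumes "0 \<le> x" "x < int n" "0 \<le> y" "y < int n"
  shows "(x, y) \<in> connection_set n \<longleftrightarrow> (x = 0 \<or> y = 0 \<or> x = y) \<and> \<not> (x = 0 \<and> y = 0)"
proof
  assume R: "(x = 0 \<or> y = 0 \<or> x = y) \<and> \<not> (x = 0 \<and> y = 0)"
  show "(x, y) \<in> connection_set n"
  proof (cases "x = 0")
    case True
    then show ?thesis using R assms unfolding connection_set_def by (intro UN_I[of y]) auto
  next
    case False
    then show ?thesis using R assms unfolding connection_set_def by (intro UN_I[of x]) auto
  qed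
qed (auto simp: connection_set_def)

lemma connection_set_iff_connector:
  assumes "n > 0"
  shows "(x mod int n, y mod int n) \<in> connection_set n \<longleftrightarrow> connector (int n) (x, y)"
  using assms
  by (simp add: mem_connection_set_iff connector_def null_mod_def mod_eq_0_iff_dvd mod_eq_dvd_iff)

lemma parcs_\<Gamma>_iff:
  assumes "n > 0" and "u \<in> pverts (\<Gamma> n)" and "v \<in> pverts (\<Gamma> n)"
  shows "(u, v) \<in> parcs (\<Gamma> n) \<longleftrightarrow> adj (int n) u v"
proof -
  obtain u1 u2 v1 v2 where [simp]: "u = (u1, u2)" "v = (v1, v2)" by (metis surj_pair)
  have u: "u1 \<in> carrier (integer_mod_group n)" "u2 \<in> carrier (integer_mod_group n)"
    using assms by (auto simp: pverts_\<Gamma> carrier_integer_mod_group)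
  have "v \<otimes>\<^bsub>Zn_square n\<^esub> inv\<^bsub>Zn_square n\<^esub> u = ((v1 - u1) mod int n, (v2 - u2) mod int n)"
    using u assms(1) unfolding Zn_square_def
    by (simp add: inv_DirProd inv_integer_mod_group mod_add_right_eq)
  then show ?thesis
    using assms connection_set_iff_connector[OF assms(1)]
    by (simp add: \<Gamma>_def cayley_graph_def adj_def)
qed

section \<open>Contradiction from a proper factorization\<close>

theorem theorem3p1:
  fixes n :: nat
  assumes "n \<ge> 4" and "\<not> prime n"
  shows "\<not> edge_transitive (\<Gamma> n)"
proof
  assume ET: "edge_transitive (\<Gamma> n)"
  let ?m = "int n" and ?V = "pverts (\<Gamma> n)"
  have pos: "n > 0" and m4: "?m \<ge> 4" using assms(1) by simp_all
  note V = pverts_\<Gamma>[OF pos]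
  obtain p q where n: "n = p * q" and p: "1 < p" "p < n" and q: "0 < q" "q < n"
  proof -
    obtain p where "p dvd n" "p \<noteq> 1" "p \<noteq> n"
      using assms unfolding prime_nat_iff by auto
    then obtain q where "n = p * q" by (auto elim: dvdE)
    moreover have "p \<noteq> 0" "q \<noteq> 0" "q \<noteq> 1"
      using \<open>n = p * q\<close> \<open>p \<noteq> n\<close> pos by auto
    ultimately show ?thesis using \<open>p \<noteq> 1\<close> by (intro that[of p q]) auto
  qed
  have edge: "{(0, 0), (a, 0)} \<in> undirected_edges (\<Gamma> n)" if "0 < a" "a < ?m" for a
  proof -
    have "adj ?m (0, 0) (a, 0)"
      using that zdvd_not_zless by (auto simp: adj_def connector_def null_mod_def)
    then show ?thesis
      using that pos parcs_\<Gamma>_iff[of n "(0, 0)" "(a, 0)"] unfolding undirected_edges_def by (auto simp: V)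
  qed
  obtain f where f: "f \<in> graph_automorphisms (\<Gamma> n)" and img: "f ` {(0, 0), (1, 0)} = {(0, 0), (int p, 0)}"
  proof -
    have "{(0, 0), (1, 0)} \<in> undirected_edges (\<Gamma> n)" "{(0, 0), (int p, 0)} \<in> undirected_edges (\<Gamma> n)"
      using edge[of 1] edge[of "int p"] p by simp_all
    then show ?thesis using ET that unfolding edge_transitive_def by blast
  qed
  have bij: "bij_betw f ?V ?V"
    using f by (simp add: graph_automorphisms_def Bij_def)
  have f_adj: "adj ?m (f u) (f v) \<longleftrightarrow> adj ?m u v" if "u \<in> ?V" "v \<in> ?V" for u v
    using f that bij_betwE[OF bij] by (auto simp: graph_automorphisms_def parcs_\<Gamma>_iff[OF pos])
  \<comment> \<open>\<open>red\<close> picks the canonical representative, so \<open>g\<close> is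
    the periodic extension of the automorphism \<open>f\<close> to all integer pairs, as
    \<open>image_of_row\<close> requires.\<close>
  define red where "red u = (fst u mod ?m, snd u mod ?m)" for u :: "int \<times> int"
  define g where "g = f \<circ> red"
  have red_V: "red u \<in> ?V" for u using pos by (simp add: red_def V)
  have red_id: "red u = u" if "u \<in> ?V" for u using that by (auto simp: red_def V)
  have red_eq: "red u = red v \<longleftrightarrow> null_mod ?m (u - v)" for u v
    by (simp add: red_def null_mod_def mod_eq_dvd_iff)
  have red_adj: "adj ?m (red u) (red v) \<longleftrightarrow> adj ?m u v" for u v
  proof -
    have "null_mod ?m ((red v - red u) - (v - u))"
      by (simp add: red_def null_mod_def mod_eq_dvd_iff[symmetric] mod_simps)
    then show ?thesis unfolding adj_def by (rule connector_cong)
  qed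
  have row: "null_mod ?m (g (int q, 0) - g (0, 0) - (int q * D1, int q * D2))"
    if "g (1, 0) - g (0, 0) = (D1, D2)" for D1 D2
  proof (rule image_of_row[OF m4 _ _ _ that])
    show "adj ?m (g u) (g v) \<longleftrightarrow> adj ?m u v" for u v
      by (simp add: g_def f_adj red_V red_adj)
    show "null_mod ?m (g u - g v) \<longleftrightarrow> null_mod ?m (u - v)" for u v
    proof -
      \<comment> \<open>Both values are canonical representatives, so their congruence is equality,
        and injectivity of \<open>f\<close> applies.\<close>
      have "g u \<in> ?V" "g v \<in> ?V" using bij_betwE[OF bij] red_V by (auto simp: g_def)
      then have "null_mod ?m (g u - g v) \<longleftrightarrow> g u = g v" by (metis red_eq red_id)
      also have "\<dots> \<longleftrightarrow> red u = red v"
        using bij_betw_imp_inj_on[OF bij] red_V by (auto simp: g_def inj_on_eq_iff)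
      finally show ?thesis by (simp add: red_eq)
    qed
    show "\<exists>x. null_mod ?m (g x - y)" for y
    proof -
      obtain x where "x \<in> ?V" "f x = red y"
        using red_V bij by (metis bij_betw_def imageE)
      then have "red (g x) = red y" using red_id red_V by (simp add: g_def)
      then show ?thesis using red_eq by blast
    qed
  qed
  have inV: "(0, 0) \<in> ?V" "(1, 0) \<in> ?V" "(int q, 0) \<in> ?V" using assms(1) q by (auto simp: V)
  have g: "g (0, 0) = f (0, 0)" "g (1, 0) = f (1, 0)" "g (int q, 0) = f (int q, 0)"
    by (simp_all add: g_def red_id[OF inV(1)] red_id[OF inV(2)] red_id[OF inV(3)])
  \<comment> \<open>Only the unordered edge is prescribed: \<open>f\<close> may exchange the ends,
    which gives the minus sign.\<close>
  have "g (1, 0) - g (0, 0) = (int p, 0) \<or> g (1, 0) - g (0, 0) = (- int p, 0)"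
    using img unfolding g by (auto simp: doubleton_eq_iff)
  \<comment> \<open>After \<open>q\<close> steps of length \<open>p\<close> in either sense the
    displacement is \<open>n\<close> or \<open>-n\<close>, hence zero modulo
    \<open>n\<close>.\<close>
  then have "null_mod ?m (g (int q, 0) - g (0, 0))"
  proof
    assume "g (1, 0) - g (0, 0) = (int p, 0)"
    then show ?thesis using row[of "int p" 0]
      by (simp add: null_mod_def n mult.commute[of "int p"]) (metis diff_add_cancel dvd_add dvd_refl)
  next
    assume "g (1, 0) - g (0, 0) = (- int p, 0)"
    then show ?thesis using row[of "- int p" 0]
      by (simp add: null_mod_def n mult.commute[of "int p"])
  qed
  then have "red (f (int q, 0)) = red (f (0, 0))" by (simp add: red_eq g)
  then have "f (int q, 0) = f (0, 0)" using red_id bij_betwE[OF bij] inV by auto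
  then have "(int q, 0::int) = (0, 0)"
    using bij_betw_imp_inj_on[OF bij] inV by (auto dest: inj_onD)
  then show False using q by simp
qed

end
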